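(* If $(X,d,\nu)$ is a weak $\mathrm{CD}(K,N)$ space with $K>0$ and $N\in(1,\infty)$, then $$\mathrm{Diam}(\mathrm{supp}\,\nu)\le\pi\sqrt{\frac{N-1}{K}},$$ where $\mathrm{Diam}(A)=\sup_{x,y\in A}d(x,y)$.
   Context: Spaces. An irreversible metric on $X$ is $d:X\times X\to[0,\infty)$ with $d(x,y)=0$ iff $x=y$ and the triangle inequality (no symmetry). Topology: generated by forward balls $B^+_x(r)=\{y:d(x,y)<r\}$. $\lambda_d(A)=\inf\{\lambda\ge1:d(x,y)\le\lambda d(y,x)\ \forall x,y\in A\}$. $(X,d)$ is a forward metric space if for some point $\star$ and some nondecreasing $\Theta:[0,\infty)\to[1,\infty)$ one has $\lambda_d(\overline{B^+_\star(r)})\le\Theta(r)$ for all $r>0$. It is forward boundedly compact if all closed forward balls are compact. It is a forward geodesic space if any $x,y$ are joined by a constant-speed minimal geodesic, i.e. continuous $\gamma:[0,1]\to X$ from $x$ to $y$ with $d(\gamma(s),\gamma(t))=(t-s)d(x,y)$ for $0\le s\le t\le1$; $\Gamma(X)$ is the set of these curves. "-measure space" means equipped with a nonnegative locally finite Borel measure. Optimal transport. $e_t(\gamma)=\gamma(t)$. An optimal transference plan from $\mu_0$ to $\mu_1$ (w.r.t. $d^2$) is a coupling $\pi$ of $(\mu_0,\mu_1)$ minimizing $\int d(x,y)^2d\pi(x,y)$. A dynamical optimal transference plan is a probability measure $\Pi$ on $\Gamma(X)$ with $(e_0,e_1)_\sharp\Pi$ optimal; $\mu_t=(e_t)_\sharp\Pi$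 is a displacement interpolation, associated with $\pi=(e_0,e_1)_\sharp\Pi$. Functionals. For $N\in[1,\infty]$, $DC_N$ is the set of continuous convex $U:[0,\infty)\to\mathbb R$, $C^2$ on $(0,\infty)$, $U(0)=0$, such that with $p(r)=rU'(r)-U(r)$ the function $r\mapsto p(r)/r^{1-1/N}$ is nondecreasing. Put $U'(\infty)=\lim_{r\to\infty}U(r)/r$. For compactly supported $\mu=\rho\nu+\mu_s$ (Lebesgue decomposition w.r.t. $\nu$), $U_\nu(\mu)=\int_XU(\rho)\,d\nu+U'(\infty)\mu_s[X]$, and for measurable $\beta:X\times X\to(0,\infty]$ and $\pi\in P(X\times X)$ with first marginal $\mu$, disintegrated as $\pi(dx\,dy)=\mu(dx)\pi(dy|x)$, $$U^\beta_{\pi,\nu}(\mu)=\int_{X\times X}U\Big(\frac{\rho(x)}{\beta(x,y)}\Big)\beta(x,y)\,\pi(dy|x)\,\nu(dx)+U'(\infty)\mu_s[X],$$ with the conventions $U(0)/0=U'(0)\in[-\infty,\infty)$, $U(\infty)/\infty=U'(\infty)$. Coefficients. $\mathfrak s_{K,N}(r)=\sqrt{\tfrac{N-1}{K}}\sin\big(r\sqrt{\tfrac{K}{N-1}}\big)$ if $K>0$, $r$ if $K=0$, $\sqrt{\tfrac{N-1}{-K}}\sinh\big(r\sqrt{\tfrac{-K}{N-1}}\big)$ if $K<0$. For $N\in(1,\infty)$, $t\in(0,1]$: $\beta^{(K,N)}_t(x,y)=\infty$ if $K>0$ and $d(x,y)\ge\pi\sqrt{(N-1)/K}$, and otherwise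 $\beta^{(K,N)}_t(x,y)=\big(\frac{\mathfrak s_{K,N}(t\,d(x,y))}{t\,\mathfrak s_{K,N}(d(x,y))}\big)^{N-1}$ (equal to $1$ if $x=y$); $\beta^{(K,N)}_0=1$. $\breve\beta(x,y)=\beta(y,x)$ and $\breve\pi$ is the image of $\pi$ under $(x,y)\mapsto(y,x)$. If $K>0$, $N\in(1,\infty)$ and $\sup_{x,y\in X}d(x,y)=\pi\sqrt{(N-1)/K}$, then $U^{\beta^{(K,N)}_t}_{\pi,\nu}$ and $U^{\breve\beta^{(K,N)}_t}_{\breve\pi,\nu}$ are defined as the limits as $N'\downarrow N$ of the same expressions with $N'$. Weak $\mathrm{CD}(K,N)$. A forward boundedly compact, $\sigma$-finite forward geodesic-measure space $(X,d,\nu)$ is a weak $\mathrm{CD}(K,N)$ space if for any two compactly supported probability measures $\mu_0,\mu_1$ with $\mathrm{supp}\,\mu_i\subset\mathrm{supp}\,\nu$ there are a displacement interpolation $(\mu_t)_{0\le t\le1}$ and an associated optimal transference plan $\pi$ from $\mu_0$ to $\mu_1$ such that for all $U\in DC_N$ and $t\in[0,1]$: $U_\nu(\mu_t)\le(1-t)\,U^{\beta^{(K,N)}_{1-t}}_{\pi,\nu}(\mu_0)+t\,U^{\breve\beta^{(K,N)}_t}_{\breve\pi,\nu}(\mu_1)$. *)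

theory Defs
  imports "HOL-Probability.Probability"
begin

section \<open>Irreversible metric spaces\<close>

text \<open>The space \<open>X\<close> is the type \<open>'a\<close>; the irreversible metric is an explicit argument \<open>d\<close>.\<close>

definition irreversible_metric :: "('a \<Rightarrow> 'a \<Rightarrow> real) \<Rightarrow> bool" where
  "irreversible_metric d \<longleftrightarrow>
     (\<forall>x y. 0 \<le> d x y) \<and> (\<forall>x y. d x y = 0 \<longleftrightarrow> x = y) \<and> (\<forall>x y z. d x z \<le> d x y + d y z)"

definition forward_ball :: "('a \<Rightarrow> 'a \<Rightarrow> real) \<Rightarrow> 'a \<Rightarrow> real \<Rightarrow> 'a set" where
  "forward_ball d x r = {y. d x y < r}"

definition forward_topology :: "('a \<Rightarrow> 'a \<Rightarrow> real) \<Rightarrow> 'a topology" where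
  "forward_topology d = topology_generated_by {forward_ball d x r |x r. 0 < r}"

definition borel_of :: "'b topology \<Rightarrow> 'b measure" where
  "borel_of T = sigma (topspace T) {V. openin T V}"

abbreviation forward_borel :: "('a \<Rightarrow> 'a \<Rightarrow> real) \<Rightarrow> 'a measure" where
  "forward_borel d \<equiv> borel_of (forward_topology d)"

text \<open>The infimum is taken in the extended reals, so that it is \<open>\<infinity>\<close> if no such \<open>c\<close> exists.\<close>

definition reversibility :: "('a \<Rightarrow> 'a \<Rightarrow> real) \<Rightarrow> 'a set \<Rightarrow> ereal" where
  "reversibility d A = Inf {ereal c |c. 1 \<le> c \<and> (\<forall>x\<in>A. \<forall>y\<in>A. d x y \<le> c * d y x)}"

definition forward_metric_space :: "('a \<Rightarrow> 'a \<Rightarrow> real) \<Rightarrow> bool" where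
  "forward_metric_space d \<longleftrightarrow> irreversible_metric d \<and>
     (\<exists>p \<Theta>. mono_on {0..} \<Theta> \<and> (\<forall>r\<ge>0. 1 \<le> \<Theta> r) \<and>
        (\<forall>r>0. reversibility d (forward_topology d closure_of forward_ball d p r) \<le> ereal (\<Theta> r)))"

definition forward_boundedly_compact :: "('a \<Rightarrow> 'a \<Rightarrow> real) \<Rightarrow> bool" where
  "forward_boundedly_compact d \<longleftrightarrow> (\<forall>x r. compactin (forward_topology d) {y. d x y \<le> r})"

definition Diam :: "('a \<Rightarrow> 'a \<Rightarrow> real) \<Rightarrow> 'a set \<Rightarrow> ennreal" where
  "Diam d A = (SUP x\<in>A. SUP y\<in>A. ennreal (d x y))"

text \<open>Curves on \<open>[0,1]\<close> are total functions on the reals, made unique by being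
  \<open>undefined\<close> off \<open>[0,1]\<close>.\<close>

definition geodesics :: "('a \<Rightarrow> 'a \<Rightarrow> real) \<Rightarrow> (real \<Rightarrow> 'a) set" where
  "geodesics d = {\<gamma> \<in> extensional {0..1}.
     continuous_map (top_of_set {0..1}) (forward_topology d) \<gamma> \<and>
     (\<forall>s t. 0 \<le> s \<and> s \<le> t \<and> t \<le> 1 \<longrightarrow> d (\<gamma> s) (\<gamma> t) = (t - s) * d (\<gamma> 0) (\<gamma> 1))}"

definition forward_geodesic_space :: "('a \<Rightarrow> 'a \<Rightarrow> real) \<Rightarrow> bool" where
  "forward_geodesic_space d \<longleftrightarrow> forward_metric_space d \<and>
     (\<forall>x y. \<exists>\<gamma>\<in>geodesics d. \<gamma> 0 = x \<and> \<gamma> 1 = y)"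

text \<open>The set of geodesics carries the topology of uniform convergence, that is, the
  compact-open topology.\<close>

definition geodesic_topology :: "('a \<Rightarrow> 'a \<Rightarrow> real) \<Rightarrow> (real \<Rightarrow> 'a) topology" where
  "geodesic_topology d = topology_generated_by
     {{\<gamma> \<in> geodesics d. \<gamma> ` C \<subseteq> V} |C V. compact C \<and> C \<subseteq> {0..1} \<and> openin (forward_topology d) V}"

section \<open>Measures\<close>

definition locally_finite_borel_measure :: "('a \<Rightarrow> 'a \<Rightarrow> real) \<Rightarrow> 'a measure \<Rightarrow> bool" where
  "locally_finite_borel_measure d \<nu> \<longleftrightarrow> sets \<nu> = sets (forward_borel d) \<and>
     (\<forall>x. \<exists>V. openin (forward_topology d) V \<and> x \<in> V \<and> emeasure \<nu> V < \<infinity>)"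

definition supp :: "('a \<Rightarrow> 'a \<Rightarrow> real) \<Rightarrow> 'a measure \<Rightarrow> 'a set" where
  "supp d \<mu> = {x. \<forall>V. openin (forward_topology d) V \<and> x \<in> V \<longrightarrow> 0 < emeasure \<mu> V}"

definition compactly_supported_prob :: "('a \<Rightarrow> 'a \<Rightarrow> real) \<Rightarrow> 'a measure \<Rightarrow> bool" where
  "compactly_supported_prob d \<mu> \<longleftrightarrow> prob_space \<mu> \<and> sets \<mu> = sets (forward_borel d) \<and>
     compactin (forward_topology d) (supp d \<mu>)"

definition lebesgue_decomposition ::
    "'a measure \<Rightarrow> 'a measure \<Rightarrow> ('a \<Rightarrow> real) \<Rightarrow> 'a measure \<Rightarrow> bool" where
  "lebesgue_decomposition \<nu> \<mu> \<rho> \<mu>s \<longleftrightarrow>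
     \<rho> \<in> borel_measurable \<nu> \<and> (\<forall>x. 0 \<le> \<rho> x) \<and> sets \<mu>s = sets \<nu> \<and>
     (\<exists>S\<in>sets \<nu>. emeasure \<nu> S = 0 \<and> emeasure \<mu>s (space \<nu> - S) = 0) \<and>
     (\<forall>A\<in>sets \<nu>. emeasure \<mu> A = emeasure (density \<nu> (\<lambda>x. ennreal (\<rho> x))) A + emeasure \<mu>s A)"

text \<open>For a finite measure \<open>\<mu>\<close> and a sigma-finite \<open>\<nu>\<close> the decomposition exists, and the two
  components chosen here are unique up to \<open>\<nu>\<close>-null sets and up to equality, respectively.\<close>

definition ac_density :: "'a measure \<Rightarrow> 'a measure \<Rightarrow> 'a \<Rightarrow> real" where
  "ac_density \<nu> \<mu> = fst (SOME (\<rho>, \<mu>s). lebesgue_decomposition \<nu> \<mu> \<rho> \<mu>s)"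

definition singular_part :: "'a measure \<Rightarrow> 'a measure \<Rightarrow> 'a measure" where
  "singular_part \<nu> \<mu> = snd (SOME (\<rho>, \<mu>s). lebesgue_decomposition \<nu> \<mu> \<rho> \<mu>s)"

text \<open>\<open>\<pi>(dx dy) = \<mu>(dx) \<kappa>(x)(dy)\<close>, with \<open>\<kappa>\<close> a Markov kernel.\<close>

definition disintegration ::
    "'a measure \<Rightarrow> ('a \<times> 'a) measure \<Rightarrow> ('a \<Rightarrow> 'a measure) \<Rightarrow> bool" where
  "disintegration \<mu> \<pi> \<kappa> \<longleftrightarrow> \<kappa> \<in> measurable \<mu> (prob_algebra \<mu>) \<and>
     sets \<pi> = sets (\<mu> \<Otimes>\<^sub>M \<mu>) \<and>
     (\<forall>A\<in>sets (\<mu> \<Otimes>\<^sub>M \<mu>). emeasure \<pi> A = (\<integral>\<^sup>+ x. emeasure (\<kappa> x) (Pair x -` A) \<partial>\<mu>))"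

section \<open>Optimal transport\<close>

definition coupling ::
    "'a measure \<Rightarrow> 'a measure \<Rightarrow> ('a \<times> 'a) measure \<Rightarrow> bool" where
  "coupling \<mu>0 \<mu>1 \<pi> \<longleftrightarrow>
     sets \<pi> = sets (\<mu>0 \<Otimes>\<^sub>M \<mu>1) \<and> distr \<pi> \<mu>0 fst = \<mu>0 \<and> distr \<pi> \<mu>1 snd = \<mu>1"

definition optimal_plan ::
    "('a \<Rightarrow> 'a \<Rightarrow> real) \<Rightarrow> 'a measure \<Rightarrow> 'a measure \<Rightarrow> ('a \<times> 'a) measure \<Rightarrow> bool" where
  "optimal_plan d \<mu>0 \<mu>1 \<pi> \<longleftrightarrow> coupling \<mu>0 \<mu>1 \<pi> \<and>
     (\<forall>\<pi>'. coupling \<mu>0 \<mu>1 \<pi>' \<longrightarrow>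
        (\<integral>\<^sup>+ (x, y). ennreal ((d x y)\<^sup>2) \<partial>\<pi>) \<le> (\<integral>\<^sup>+ (x, y). ennreal ((d x y)\<^sup>2) \<partial>\<pi>'))"

definition endpoint_plan ::
    "('a \<Rightarrow> 'a \<Rightarrow> real) \<Rightarrow> (real \<Rightarrow> 'a) measure \<Rightarrow> ('a \<times> 'a) measure" where
  "endpoint_plan d Q = distr Q (forward_borel d \<Otimes>\<^sub>M forward_borel d) (\<lambda>\<gamma>. (\<gamma> 0, \<gamma> 1))"

definition interpolation ::
    "('a \<Rightarrow> 'a \<Rightarrow> real) \<Rightarrow> (real \<Rightarrow> 'a) measure \<Rightarrow> real \<Rightarrow> 'a measure" where
  "interpolation d Q t = distr Q (forward_borel d) (\<lambda>\<gamma>. \<gamma> t)"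

definition dynamical_optimal_plan ::
    "('a \<Rightarrow> 'a \<Rightarrow> real) \<Rightarrow> 'a measure \<Rightarrow> 'a measure \<Rightarrow> (real \<Rightarrow> 'a) measure \<Rightarrow> bool" where
  "dynamical_optimal_plan d \<mu>0 \<mu>1 Q \<longleftrightarrow>
     prob_space Q \<and> sets Q = sets (borel_of (geodesic_topology d)) \<and>
     optimal_plan d \<mu>0 \<mu>1 (endpoint_plan d Q)"

section \<open>Nonlinear functionals\<close>

text \<open>Functions on \<open>[0,\<infinity>)\<close> are total functions on the reals whose values at negative
  arguments are never used.\<close>

definition pressure :: "(real \<Rightarrow> real) \<Rightarrow> real \<Rightarrow> real" where
  "pressure U r = r * deriv U r - U r"

definition DC :: "real \<Rightarrow> (real \<Rightarrow> real) set" where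
  "DC N = {U. continuous_on {0..} U \<and> convex_on {0..} U \<and>
     (\<forall>r>0. U differentiable (at r)) \<and> (\<forall>r>0. deriv U differentiable (at r)) \<and>
     continuous_on {0<..} (deriv (deriv U)) \<and> U 0 = 0 \<and>
     mono_on {0<..} (\<lambda>r. pressure U r / r powr (1 - 1 / N))}"

definition slope_at_infinity :: "(real \<Rightarrow> real) \<Rightarrow> ereal" where
  "slope_at_infinity U = Lim at_top (\<lambda>r. ereal (U r / r))"

definition slope_at_zero :: "(real \<Rightarrow> real) \<Rightarrow> ereal" where
  "slope_at_zero U = Lim (at_right 0) (\<lambda>r. ereal (U r / r))"

text \<open>\<open>U(r/b) b\<close> for \<open>b \<in> (0,\<infinity>]\<close>. For \<open>b = \<infinity>\<close> it is read as \<open>r \<cdot> (U(r/b) / (r/b))\<close> with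
  \<open>U(0)/0 = U'(0)\<close>; in the extended reals \<open>0 \<cdot> (-\<infinity>) = 0\<close>.\<close>

definition perspective :: "(real \<Rightarrow> real) \<Rightarrow> real \<Rightarrow> ereal \<Rightarrow> ereal" where
  "perspective U r b =
     (if b = \<infinity> then ereal r * slope_at_zero U
      else ereal (U (r / real_of_ereal b) * real_of_ereal b))"

text \<open>Integrals of extended real functions are differences of the integrals of positive and
  negative part. In type \<open>ereal\<close>, \<open>\<infinity> - \<infinity>\<close> and \<open>\<infinity> + (-\<infinity>)\<close> are \<open>\<infinity>\<close>; thus an undefined right-hand side
  in the displacement convexity inequality below imposes no condition.\<close>

definition U_functional :: "(real \<Rightarrow> real) \<Rightarrow> 'a measure \<Rightarrow> 'a measure \<Rightarrow> ereal" where
  "U_functional U \<nu> \<mu> =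
     enn2ereal (\<integral>\<^sup>+ x. ennreal (U (ac_density \<nu> \<mu> x)) \<partial>\<nu>)
     - enn2ereal (\<integral>\<^sup>+ x. ennreal (- U (ac_density \<nu> \<mu> x)) \<partial>\<nu>)
     + slope_at_infinity U * enn2ereal (emeasure (singular_part \<nu> \<mu>) (space \<nu>))"

text \<open>Here \<open>\<kappa>\<close> is a disintegration with respect to \<open>\<mu>\<close> of the plan \<open>\<pi>\<close>. The value does not
  depend on its choice, because the integrand vanishes where the density does.\<close>

definition U_beta_functional ::
    "(real \<Rightarrow> real) \<Rightarrow> ('a \<Rightarrow> 'a \<Rightarrow> ereal) \<Rightarrow> ('a \<Rightarrow> 'a measure) \<Rightarrow> 'a measure \<Rightarrow> 'a measure \<Rightarrow> ereal"
  where
  "U_beta_functional U \<beta> \<kappa> \<nu> \<mu> =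
     enn2ereal (\<integral>\<^sup>+ x. \<integral>\<^sup>+ y. e2ennreal (perspective U (ac_density \<nu> \<mu> x) (\<beta> x y)) \<partial>\<kappa> x \<partial>\<nu>)
     - enn2ereal (\<integral>\<^sup>+ x. \<integral>\<^sup>+ y. e2ennreal (- perspective U (ac_density \<nu> \<mu> x) (\<beta> x y)) \<partial>\<kappa> x \<partial>\<nu>)
     + slope_at_infinity U * enn2ereal (emeasure (singular_part \<nu> \<mu>) (space \<nu>))"

section \<open>Distortion coefficients and the weak curvature-dimension condition\<close>

text \<open>From here on the dimension parameter \<open>N\<close> is meant to lie in \<open>(1,\<infinity>)\<close>.\<close>

definition sKN :: "real \<Rightarrow> real \<Rightarrow> real \<Rightarrow> real" where
  "sKN K N r =
     (if K > 0 then sqrt ((N - 1) / K) * sin (r * sqrt (K / (N - 1)))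
      else if K = 0 then r
      else sqrt ((N - 1) / (- K)) * sinh (r * sqrt (- K / (N - 1))))"

definition betaKN ::
    "('a \<Rightarrow> 'a \<Rightarrow> real) \<Rightarrow> real \<Rightarrow> real \<Rightarrow> real \<Rightarrow> 'a \<Rightarrow> 'a \<Rightarrow> ereal" where
  "betaKN d K t N x y =
     (if t = 0 then 1
      else if K > 0 \<and> d x y \<ge> pi * sqrt ((N - 1) / K) then \<infinity>
      else if x = y then 1
      else ereal ((sKN K N (t * d x y) / (t * sKN K N (d x y))) powr (N - 1)))"

text \<open>\<open>b N'\<close> is the coefficient function for the dimension parameter \<open>N'\<close>.\<close>

definition U_KN_functional ::
    "('a \<Rightarrow> 'a \<Rightarrow> real) \<Rightarrow> real \<Rightarrow> real \<Rightarrow> (real \<Rightarrow> real) \<Rightarrow> (real \<Rightarrow> 'a \<Rightarrow> 'a \<Rightarrow> ereal) \<Rightarrow>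
      ('a \<Rightarrow> 'a measure) \<Rightarrow> 'a measure \<Rightarrow> 'a measure \<Rightarrow> ereal" where
  "U_KN_functional d K N U b \<kappa> \<nu> \<mu> =
     (if K > 0 \<and> N > 1 \<and> Diam d UNIV = ennreal (pi * sqrt ((N - 1) / K))
      then Lim (at_right N) (\<lambda>N'. U_beta_functional U (b N') \<kappa> \<nu> \<mu>)
      else U_beta_functional U (b N) \<kappa> \<nu> \<mu>)"

definition weak_CD :: "('a \<Rightarrow> 'a \<Rightarrow> real) \<Rightarrow> 'a measure \<Rightarrow> real \<Rightarrow> real \<Rightarrow> bool" where
  "weak_CD d \<nu> K N \<longleftrightarrow>
     forward_geodesic_space d \<and> forward_boundedly_compact d \<and>
     locally_finite_borel_measure d \<nu> \<and> sigma_finite_measure \<nu> \<and>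
     (\<forall>\<mu>0 \<mu>1. compactly_supported_prob d \<mu>0 \<and> compactly_supported_prob d \<mu>1 \<and>
        supp d \<mu>0 \<subseteq> supp d \<nu> \<and> supp d \<mu>1 \<subseteq> supp d \<nu> \<longrightarrow>
        (\<exists>Q \<pi> \<kappa>0 \<kappa>1.
           dynamical_optimal_plan d \<mu>0 \<mu>1 Q \<and> \<pi> = endpoint_plan d Q \<and>
           disintegration \<mu>0 \<pi> \<kappa>0 \<and>
           disintegration \<mu>1 (distr \<pi> (\<mu>1 \<Otimes>\<^sub>M \<mu>0) (\<lambda>(x, y). (y, x))) \<kappa>1 \<and>
           (\<forall>U\<in>DC N. \<forall>t\<in>{0..1}.
              U_functional U \<nu> (interpolation d Q t)
              \<le> ereal (1 - t) * U_KN_functional d K N U (betaKN d K (1 - t)) \<kappa>0 \<nu> \<mu>0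
                + ereal t * U_KN_functional d K N U (\<lambda>N' x y. betaKN d K t N' y x) \<kappa>1 \<nu> \<mu>1)))"

end

theory Submission
  imports Defs "HOL-Real_Asymp.Real_Asymp"
begin

text \<open>If two points of the support were at distance greater than the bound, so would be all pairs
  of points from two small forward balls around them. Take for \<open>\<mu>0\<close> and \<open>\<mu>1\<close> the uniform measures
  on these balls. Every optimal plan lives on pairs with \<open>\<beta> = \<infinity>\<close>, so for \<open>U r = - r powr (1 - 1 / N)\<close>,
  whose slope at \<open>0\<close> is \<open>-\<infinity>\<close>, the right-hand side of the displacement convexity inequality at
  \<open>t = 1 / 2\<close> is \<open>-\<infinity>\<close>. The left-hand side is finite: the midpoint measure is carried by a bounded
  set, which has finite \<open>\<nu>\<close>-measure, and \<open>r powr (1 - 1 / N) \<le> 1 + r\<close>.\<close>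

section \<open>The forward topology\<close>

lemma irreversible_metricD:
  assumes "irreversible_metric d"
  shows "0 \<le> d x y" "d x x = 0" "d x z \<le> d x y + d y z"
  using assms unfolding irreversible_metric_def by blast+

lemma topspace_forward_topology:
  assumes "irreversible_metric d"
  shows "topspace (forward_topology d) = UNIV"
proof -
  have "x \<in> topspace (forward_topology d)" for x
  proof -
    have "x \<in> forward_ball d x 1"
      by (simp add: forward_ball_def irreversible_metricD[OF assms])
    moreover have "forward_ball d x 1 \<in> {forward_ball d x r |x r. 0 < r}"
      using zero_less_one by blast
    ultimately show ?thesis
      unfolding forward_topology_def topology_generated_by_topspace by (rule UnionI[rotated])
  qed
  then show ?thesis
    by blast
qed

lemma openin_forward_ball:
  assumes "0 < r"
  shows "openin (forward_topology d) (forward_ball d x r)"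
  unfolding forward_topology_def using assms by (blast intro: topology_generated_by_Basis)

lemma centre_in_forward_ball:
  assumes "irreversible_metric d" "0 < r"
  shows "x \<in> forward_ball d x r"
  using assms(2) by (simp add: forward_ball_def irreversible_metricD[OF assms(1)])

section \<open>Borel sets generated by a topology\<close>

lemma space_borel_of: "space (borel_of T) = topspace T"
  by (simp add: borel_of_def space_measure_of_conv)

lemma sets_borel_of_openin:
  assumes "openin T V"
  shows "V \<in> sets (borel_of T)"
proof -
  have "{V. openin T V} \<subseteq> Pow (topspace T)"
    by (auto dest: openin_subset)
  then show ?thesis
    using assms by (auto simp: borel_of_def sets_measure_of)
qed

lemma continuous_map_borel_of_measurable:
  assumes "continuous_map S T f"
  shows "f \<in> borel_of S \<rightarrow>\<^sub>M borel_of T"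
  unfolding borel_of_def[of T]
proof (rule measurable_sigma_sets)
  show "sets (sigma (topspace T) {V. openin T V}) = sigma_sets (topspace T) {V. openin T V}"
    by (rule sets_measure_of) (auto dest: openin_subset)
  show "{V. openin T V} \<subseteq> Pow (topspace T)"
    by (auto dest: openin_subset)
  show "f \<in> space (borel_of S) \<rightarrow> topspace T"
    using assms by (auto simp: space_borel_of continuous_map_def)
  fix V assume "V \<in> {V. openin T V}"
  then have "openin S {x \<in> topspace S. f x \<in> V}"
    using assms by (simp add: continuous_map_def)
  moreover have "f -` V \<inter> space (borel_of S) = {x \<in> topspace S. f x \<in> V}"
    by (auto simp: space_borel_of)
  ultimately show "f -` V \<inter> space (borel_of S) \<in> sets (borel_of S)"
    by (simp add: sets_borel_of_openin)
qed

text \<open>By the triangle inequality the unit ball about \<open>x\<close> lies in a ball about the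
  base point, and on the closure of the latter reversibility is bounded. This is the substitute for
  symmetry wherever a distance has to be reversed.\<close>

lemma locally_reversible:
  assumes "forward_metric_space d"
  obtains c where "1 \<le> c"
    "\<And>y z. y \<in> forward_ball d x 1 \<Longrightarrow> z \<in> forward_ball d x 1 \<Longrightarrow> d y z \<le> c * d z y"
proof -
  obtain p \<Theta> where d: "irreversible_metric d"
    and rev: "\<And>r. 0 < r \<Longrightarrow>
      reversibility d (forward_topology d closure_of forward_ball d p r) \<le> ereal (\<Theta> r)"
    using assms by (auto simp: forward_metric_space_def)
  let ?R = "d p x + 1"
  let ?C = "forward_topology d closure_of forward_ball d p ?R"
  have "0 < ?R"
    by (simp add: irreversible_metricD[OF d] add_nonneg_pos)
  then have "reversibility d ?C \<le> ereal (\<Theta> ?R)"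
    by (rule rev)
  also have "\<dots> < \<infinity>"
    by simp
  finally obtain c where c: "1 \<le> c" "\<And>y z. y \<in> ?C \<Longrightarrow> z \<in> ?C \<Longrightarrow> d y z \<le> c * d z y"
    unfolding reversibility_def Inf_less_iff by blast
  have "forward_ball d x 1 \<subseteq> forward_ball d p ?R"
  proof
    fix y assume "y \<in> forward_ball d x 1"
    moreover have "d p y \<le> d p x + d x y"
      by (rule irreversible_metricD[OF d])
    ultimately show "y \<in> forward_ball d p ?R"
      by (simp add: forward_ball_def)
  qed
  also have "\<dots> \<subseteq> ?C"
    by (rule closure_of_subset) (simp add: topspace_forward_topology[OF d])
  finally show thesis
    using that c by blast
qed

text \<open>Points \<open>z\<close> near \<open>y\<close> have small \<open>d y z\<close>, but the
  triangle inequality from \<open>x\<close> through \<open>z\<close> to \<open>y\<close> calls for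
  small \<open>d z y\<close>. Local reversibility converts one into the other at the cost of a
  factor.\<close>

lemma closedin_forward_cball:
  assumes "forward_metric_space d"
  shows "closedin (forward_topology d) {y. d x y \<le> r}"
proof -
  have d: "irreversible_metric d"
    using assms by (simp add: forward_metric_space_def)
  have "openin (forward_topology d) {y. r < d x y}"
  proof (subst openin_subopen, intro ballI)
    fix y assume "y \<in> {y. r < d x y}"
    then have y: "r < d x y"
      by simp
    obtain c where c: "1 \<le> c"
      "\<And>u v. u \<in> forward_ball d y 1 \<Longrightarrow> v \<in> forward_ball d y 1 \<Longrightarrow> d u v \<le> c * d v u"
      using locally_reversible[OF assms] by blast
    \<comment> \<open>The cap 1 keeps the ball inside the region of local reversibility. The
      quotient keeps the reversed distance, at most \<open>c\<close> times the radius, within the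
      margin \<open>d x y - r\<close>.\<close>
    define \<delta> where "\<delta> = min 1 ((d x y - r) / c)"
    have \<delta>: "0 < \<delta>" "\<delta> \<le> 1" "c * \<delta> \<le> d x y - r"
      using c(1) y by (auto simp: \<delta>_def min_def field_simps)
    have "forward_ball d y \<delta> \<subseteq> {y. r < d x y}"
    proof
      fix z assume "z \<in> forward_ball d y \<delta>"
      then have z: "d y z < \<delta>"
        by (simp add: forward_ball_def)
      then have "z \<in> forward_ball d y 1"
        using \<delta> by (simp add: forward_ball_def)
      then have "d z y \<le> c * d y z"
        by (intro c(2) centre_in_forward_ball[OF d]) auto
      also have "\<dots> < c * \<delta>"
        using c(1) z by simp
      finally have "d z y < d x y - r"
        using \<delta>(3) by linarith
      moreover have "d x y \<le> d x z + d z y"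
        by (rule irreversible_metricD[OF d])
      ultimately show "z \<in> {y. r < d x y}"
        by simp
    qed
    then show "\<exists>T. openin (forward_topology d) T \<and> y \<in> T \<and> T \<subseteq> {y. r < d x y}"
      using openin_forward_ball[OF \<delta>(1), of d y] centre_in_forward_ball[OF d \<delta>(1), of y] by blast
  qed
  moreover have "{y. r < d x y} = topspace (forward_topology d) - {y. d x y \<le> r}"
    by (auto simp: topspace_forward_topology[OF d])
  ultimately show ?thesis
    by (simp add: closedin_def topspace_forward_topology[OF d])
qed

text \<open>Finitely many open sets of finite measure cover \<open>C\<close>. With \<open>C\<close>
  a compact closed forward ball, this makes forward balls have finite measure.\<close>

lemma emeasure_compactin_finite:
  assumes "locally_finite_borel_measure d \<nu>" "compactin (forward_topology d) C"
    "A \<subseteq> C"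
  shows "emeasure \<nu> A < \<infinity>"
proof -
  have sets: "sets \<nu> = sets (forward_borel d)"
    using assms(1) by (simp add: locally_finite_borel_measure_def)
  let ?V = "{V. openin (forward_topology d) V \<and> emeasure \<nu> V < \<infinity>}"
  have "C \<subseteq> \<Union>?V"
    using assms(1) unfolding locally_finite_borel_measure_def by blast
  then obtain F where F: "finite F" "F \<subseteq> ?V" "C \<subseteq> \<Union>F"
    using compactinD[OF assms(2), of ?V] by auto
  have in_sets: "V \<in> sets \<nu>" if "V \<in> F" for V
    using that F(2) by (auto simp: sets intro: sets_borel_of_openin)
  have "emeasure \<nu> A \<le> emeasure \<nu> (\<Union>F)"
    using assms(3) F in_sets by (intro emeasure_mono) auto
  also have "\<dots> \<le> (\<Sum>V\<in>F. emeasure \<nu> V)"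
    using emeasure_subadditive_finite[of F "\<lambda>V. V" \<nu>] F(1) in_sets by auto
  also have "\<dots> < \<infinity>"
    using F by (auto simp: less_top[symmetric] simp flip: top.not_eq_extremum)
  finally show ?thesis .
qed

section \<open>Lebesgue decomposition\<close>

text \<open>The singular part lives on a \<open>\<nu>\<close>-null set of maximal \<open>\<mu>\<close>-measure.\<close>

lemma lebesgue_decomposition_exists:
  assumes "sigma_finite_measure \<nu>" "finite_measure \<mu>" and sets: "sets \<mu> = sets \<nu>"
  shows "\<exists>\<rho> \<mu>s. lebesgue_decomposition \<nu> \<mu> \<rho> \<mu>s"
proof -
  interpret \<nu>: sigma_finite_measure \<nu> by fact
  interpret \<mu>: finite_measure \<mu> by fact
  have space: "space \<mu> = space \<nu>"
    using sets by (rule sets_eq_imp_space_eq)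
  have "null_sets \<nu> \<noteq> {}"
    by auto
  \<comment> \<open>A sequence of null sets is chosen whose \<mu>-measures have the same supremum as
    those of all null sets; their union \<open>S\<close> then attains it.\<close>
  then obtain f :: "nat \<Rightarrow> ennreal" where f: "range f \<subseteq> emeasure \<mu> ` null_sets \<nu>"
    "(SUP A\<in>null_sets \<nu>. emeasure \<mu> A) = Sup (range f)"
    using ennreal_Sup_countable_SUP[of "emeasure \<mu> ` null_sets \<nu>"] by auto
  then have "\<exists>A\<in>null_sets \<nu>. emeasure \<mu> A = f n" for n
    by (metis imageE range_subsetD)
  then obtain A where A: "\<And>n. A n \<in> null_sets \<nu>" "\<And>n. emeasure \<mu> (A n) = f n"
    by metis
  define S where "S = (\<Union>n. A n)"
  have S: "S \<in> null_sets \<nu>"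
    unfolding S_def using A(1) by auto
  then have S_sets[measurable]: "S \<in> sets \<nu>" "S \<in> sets \<mu>"
    by (auto simp: sets)
  have max: "emeasure \<mu> B \<le> emeasure \<mu> S" if "B \<in> null_sets \<nu>" for B
  proof -
    have "emeasure \<mu> B \<le> Sup (range f)"
      using that f(2) by (metis SUP_upper)
    also have "\<dots> \<le> emeasure \<mu> S"
      using A S_sets by (auto intro!: SUP_least emeasure_mono simp flip: A(2) simp: S_def)
    finally show ?thesis .
  qed
  define \<mu>a where "\<mu>a = density \<mu> (indicator (space \<nu> - S))"
  have emeasure_\<mu>a: "emeasure \<mu>a B = emeasure \<mu> (B - S)" if "B \<in> sets \<nu>" for B
  proof -
    have "emeasure \<mu>a B = emeasure \<mu> ((space \<nu> - S) \<inter> B)"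
      using that by (simp add: \<mu>a_def sets emeasure_restricted)
    also have "(space \<nu> - S) \<inter> B = B - S"
      using sets.sets_into_space[OF that] by auto
    finally show ?thesis .
  qed
  have "absolutely_continuous \<nu> \<mu>a"
    unfolding absolutely_continuous_def
  proof
    fix B assume B: "B \<in> null_sets \<nu>"
    then have [measurable]: "B \<in> sets \<mu>"
      by (auto simp: sets)
    \<comment> \<open>The union of \<open>S\<close> with a null set \<open>B\<close> is again null,
      so maximality of \<open>S\<close> leaves no mass for \<open>B - S\<close>. Cancelling uses
      that \<mu> is finite.\<close>
    have "emeasure \<mu> S + emeasure \<mu> (B - S) = emeasure \<mu> (S \<union> (B - S))"
      by (rule plus_emeasure) auto
    also have "\<dots> \<le> emeasure \<mu> S"
      using S B by (intro max) (auto simp: Un_Diff_cancel)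
    finally have "emeasure \<mu> S + emeasure \<mu> (B - S) \<le> emeasure \<mu> S + 0"
      by simp
    then have "emeasure \<mu> (B - S) = 0"
      by (subst (asm) ennreal_add_left_cancel_le) (auto simp: \<mu>.emeasure_finite)
    then show "B \<in> null_sets \<mu>a"
      using B emeasure_\<mu>a[of B] by (auto simp: null_sets_def \<mu>a_def sets)
  qed
  moreover have "finite_measure \<mu>a"
    using emeasure_\<mu>a[of "space \<nu>"] space
    by (intro finite_measureI) (auto simp: \<mu>a_def \<mu>.emeasure_finite)
  moreover have sets_\<mu>a: "sets \<mu>a = sets \<nu>"
    by (simp add: \<mu>a_def sets)
  \<comment> \<open>Finiteness of \<open>\<mu>a\<close> makes the Radon-Nikodym derivative finite
    almost everywhere, so it has a real-valued version.\<close>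
  ultimately obtain \<rho> where \<rho>: "\<rho> \<in> borel_measurable \<nu>"
    "AE x in \<nu>. RN_deriv \<nu> \<mu>a x = ennreal (\<rho> x)" "\<And>x. 0 \<le> \<rho> x"
    using \<nu>.real_RN_deriv by metis
  have "density \<nu> (\<lambda>x. ennreal (\<rho> x)) = density \<nu> (RN_deriv \<nu> \<mu>a)"
    using \<rho> by (intro density_cong) auto
  also have "\<dots> = \<mu>a"
    using \<open>absolutely_continuous \<nu> \<mu>a\<close> sets_\<mu>a by (rule \<nu>.density_RN_deriv)
  finally have dens: "density \<nu> (\<lambda>x. ennreal (\<rho> x)) = \<mu>a" .
  define \<mu>s where "\<mu>s = density \<mu> (indicator S)"
  have emeasure_\<mu>s: "emeasure \<mu>s B = emeasure \<mu> (S \<inter> B)" if "B \<in> sets \<nu>" for B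
    using that by (simp add: \<mu>s_def sets emeasure_restricted)
  have "lebesgue_decomposition \<nu> \<mu> \<rho> \<mu>s"
    unfolding lebesgue_decomposition_def dens
  proof (intro conjI ballI allI bexI[of _ S])
    fix B assume B: "B \<in> sets \<nu>"
    have "emeasure \<mu> ((B - S) \<union> (S \<inter> B)) = emeasure \<mu> (B - S) + emeasure \<mu> (S \<inter> B)"
      using B by (intro plus_emeasure[symmetric]) (auto simp: sets)
    moreover have "(B - S) \<union> (S \<inter> B) = B"
      by auto
    ultimately show "emeasure \<mu> B = emeasure \<mu>a B + emeasure \<mu>s B"
      using B by (simp add: emeasure_\<mu>a emeasure_\<mu>s)
  next
    show "emeasure \<mu>s (space \<nu> - S) = 0"
      by (subst emeasure_\<mu>s) auto
  qed (use S \<rho> in \<open>auto simp: \<mu>s_def sets\<close>)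
  then show ?thesis
    by blast
qed

text \<open>Both definitions project the same \<open>SOME\<close> term, so density and singular part
  belong to one and the same decomposition.\<close>

lemma lebesgue_decomposition_chosen:
  assumes "sigma_finite_measure \<nu>" "finite_measure \<mu>" "sets \<mu> = sets \<nu>"
  shows "lebesgue_decomposition \<nu> \<mu> (ac_density \<nu> \<mu>) (singular_part \<nu> \<mu>)"
proof -
  let ?P = "\<lambda>(\<rho>, \<mu>s). lebesgue_decomposition \<nu> \<mu> \<rho> \<mu>s"
  have "\<exists>x. ?P x"
    using lebesgue_decomposition_exists[OF assms] by auto
  then have "?P (Eps ?P)"
    by (rule someI_ex)
  then show ?thesis
    by (simp add: ac_density_def singular_part_def split_def)
qed

lemma nn_integral_ac_density_le:
  assumes "lebesgue_decomposition \<nu> \<mu> \<rho> \<mu>s" "A \<in> sets \<nu>"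
  shows "(\<integral>\<^sup>+ x. ennreal (\<rho> x) * indicator A x \<partial>\<nu>) \<le> emeasure \<mu> A"
proof -
  have "\<rho> \<in> borel_measurable \<nu>"
    using assms(1) by (simp add: lebesgue_decomposition_def)
  then have "(\<integral>\<^sup>+ x. ennreal (\<rho> x) * indicator A x \<partial>\<nu>) = emeasure (density \<nu> (\<lambda>x. ennreal (\<rho> x))) A"
    using assms(2) by (simp add: emeasure_density)
  then show ?thesis
    using assms by (simp add: lebesgue_decomposition_def)
qed

text \<open>Cut the zero set of \<rho> along the null set \<open>S\<close> that carries
  \<open>\<mu>s\<close>: outside \<open>S\<close> neither summand gives it mass, and
  \<open>S\<close> itself is \<mu>-null by absolute continuity. Positivity matters because, at
  coefficient \<infinity>, the perspective of the Renyi function is -\<infinity> only for a positive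
  density.\<close>

lemma AE_ac_density_pos:
  assumes dec: "lebesgue_decomposition \<nu> \<mu> \<rho> \<mu>s" and ac: "absolutely_continuous \<nu> \<mu>"
    and sets: "sets \<mu> = sets \<nu>"
  shows "AE x in \<mu>. 0 < \<rho> x"
proof -
  obtain S where \<rho>[measurable]: "\<rho> \<in> borel_measurable \<nu>" and pos: "\<And>x. 0 \<le> \<rho> x"
    and S: "S \<in> sets \<nu>" "emeasure \<nu> S = 0" "emeasure \<mu>s (space \<nu> - S) = 0"
    and sum: "\<And>A. A \<in> sets \<nu> \<Longrightarrow>
      emeasure \<mu> A = emeasure (density \<nu> (\<lambda>x. ennreal (\<rho> x))) A + emeasure \<mu>s A"
    and sets_s: "sets \<mu>s = sets \<nu>"
    using dec by (auto simp: lebesgue_decomposition_def)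
  note [measurable] = S(1)
  define Z where "Z = {x \<in> space \<nu>. \<rho> x = 0}"
  have Z[measurable]: "Z \<in> sets \<nu>"
    unfolding Z_def by measurable
  have "emeasure \<mu>s (Z - S) \<le> emeasure \<mu>s (space \<nu> - S)"
    by (intro emeasure_mono) (auto simp: Z_def sets_s)
  then have "emeasure \<mu>s (Z - S) = 0"
    using S(3) by simp
  moreover have "emeasure (density \<nu> (\<lambda>x. ennreal (\<rho> x))) (Z - S) = (\<integral>\<^sup>+ x. 0 \<partial>\<nu>)"
    unfolding emeasure_density[OF measurable_compose[OF \<rho> measurable_ennreal] sets.Diff[OF Z S(1)]]
    by (intro nn_integral_cong) (auto simp: Z_def split: split_indicator)
  ultimately have "emeasure \<mu> (Z - S) = 0"
    by (subst sum) auto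
  then have "Z - S \<in> null_sets \<mu>"
    by (auto simp: sets)
  moreover have "S \<in> null_sets \<mu>"
    using ac S(1,2) unfolding absolutely_continuous_def by blast
  ultimately have "(Z - S) \<union> S \<in> null_sets \<mu>"
    by (rule null_sets.Un)
  then show ?thesis
    by (rule AE_I') (use pos sets_eq_imp_space_eq[OF sets] in \<open>auto simp: Z_def less_le\<close>)
qed

section \<open>Uniform measures on balls\<close>

text \<open>A ball about a support point has positive measure, and finite measure because the closed
  ball is compact. The support of the uniform measure is a closed subset of that compact
  ball.\<close>

lemma compactly_supported_uniform_measure:
  assumes "forward_metric_space d" "forward_boundedly_compact d"
    "locally_finite_borel_measure d \<nu>" "x \<in> supp d \<nu>" "0 < r"
  shows "compactly_supported_prob d (uniform_measure \<nu> (forward_ball d x r))" (is ?comp)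
    and "supp d (uniform_measure \<nu> (forward_ball d x r)) \<subseteq> supp d \<nu>" (is ?sub)
    and "prob_space (uniform_measure \<nu> (forward_ball d x r))" (is ?prob)
proof -
  let ?T = "forward_topology d" and ?B = "forward_ball d x r" and ?C = "{y. d x y \<le> r}"
  let ?\<mu> = "uniform_measure \<nu> ?B"
  have d: "irreversible_metric d"
    using assms(1) by (simp add: forward_metric_space_def)
  have sets: "sets \<nu> = sets (forward_borel d)"
    using assms(3) by (simp add: locally_finite_borel_measure_def)
  have B: "?B \<in> sets \<nu>"
    unfolding sets by (rule sets_borel_of_openin) (rule openin_forward_ball[OF assms(5)])
  have C: "compactin ?T ?C"
    using assms(2) by (simp add: forward_boundedly_compact_def)
  have "0 < emeasure \<nu> ?B"
    using assms(4) openin_forward_ball[OF assms(5), of d x]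
      centre_in_forward_ball[OF d assms(5), of x]
    unfolding supp_def by blast
  moreover have "emeasure \<nu> ?B < \<infinity>"
    by (rule emeasure_compactin_finite[OF assms(3) C]) (auto simp: forward_ball_def)
  ultimately show ?prob
    by (intro prob_space_uniform_measure) auto
  have null: "emeasure ?\<mu> V = 0" if "openin ?T V" "emeasure \<nu> (?B \<inter> V) = 0" for V
    using that B by (simp add: sets sets_borel_of_openin)
  show ?sub
  proof
    fix y assume y: "y \<in> supp d ?\<mu>"
    have "0 < emeasure \<nu> V" if V: "openin ?T V" "y \<in> V" for V
    proof (rule ccontr)
      assume "\<not> 0 < emeasure \<nu> V"
      then have "emeasure \<nu> (?B \<inter> V) = 0"
        using emeasure_mono[of "?B \<inter> V" V \<nu>] V by (simp add: sets sets_borel_of_openin)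
      then show False
        using null[OF V(1)] y V by (auto simp: supp_def)
    qed
    then show "y \<in> supp d \<nu>"
      by (simp add: supp_def)
  qed
  have "supp d ?\<mu> \<subseteq> ?C"
  proof (rule ccontr)
    assume "\<not> supp d ?\<mu> \<subseteq> ?C"
    then obtain y where y: "y \<in> supp d ?\<mu>" "y \<notin> ?C"
      by blast
    \<comment> \<open>The complement of the closed ball is an open set of measure zero, so it
      contains no support point.\<close>
    have "openin ?T (topspace ?T - ?C)"
      by (rule openin_diff[OF openin_topspace closedin_forward_cball[OF assms(1)]])
    moreover have "?B \<inter> (topspace ?T - ?C) = {}"
      by (auto simp: forward_ball_def)
    ultimately show False
      using null[of "topspace ?T - ?C"] y
      by (auto simp: supp_def topspace_forward_topology[OF d])
  qed
  moreover have "closedin ?T (supp d ?\<mu>)"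
  proof -
    have "topspace ?T - supp d ?\<mu> = \<Union>{V. openin ?T V \<and> emeasure ?\<mu> V = 0}"
      by (auto simp: supp_def topspace_forward_topology[OF d])
    also have "openin ?T \<dots>"
      by (rule openin_Union) auto
    finally show ?thesis
      by (simp add: closedin_def topspace_forward_topology[OF d])
  qed
  ultimately have "compactin ?T (supp d ?\<mu>)"
    using C closed_compactin by blast
  then show ?comp
    using \<open>?prob\<close> by (simp add: compactly_supported_prob_def sets)
qed

section \<open>The Renyi entropy\<close>

text \<open>Up to a positive factor and a linear term this is the usual function N (r - r^(1 -
  1/N)). The convention that 0 \<open>powr\<close> anything is 0 supplies the required value at
  0.\<close>

definition renyi :: "real \<Rightarrow> real \<Rightarrow> real" where
  "renyi N r = - (r powr (1 - 1 / N))"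

lemma renyi_nonpos: "renyi N r \<le> 0"
  by (simp add: renyi_def)

lemma has_real_derivative_renyi:
  assumes "0 < r"
  shows "(renyi N has_real_derivative - (1 - 1 / N) * r powr (- 1 / N)) (at r)"
  unfolding renyi_def using assms by (auto intro!: derivative_eq_intros simp: algebra_simps)

lemma has_real_derivative_deriv_renyi:
  assumes "1 < N" "0 < r"
  shows "((\<lambda>r. - (1 - 1 / N) * r powr (- 1 / N)) has_real_derivative
    (1 - 1 / N) * (1 / N) * r powr (- 1 / N - 1)) (at r)"
  using assms by (auto intro!: derivative_eq_intros simp: field_simps)

lemma deriv_renyi: "0 < r \<Longrightarrow> deriv (renyi N) r = - (1 - 1 / N) * r powr (- 1 / N)"
  by (rule DERIV_imp_deriv[OF has_real_derivative_renyi])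

text \<open>The formula for \<open>deriv (renyi N)\<close> is available at positive arguments only,
  hence the transfer within an open half-line.\<close>

lemma has_real_derivative_deriv_renyi':
  assumes "1 < N" "0 < r"
  shows "(deriv (renyi N) has_real_derivative (1 - 1 / N) * (1 / N) * r powr (- 1 / N - 1)) (at r)"
  by (rule has_field_derivative_transform_within_open
      [OF has_real_derivative_deriv_renyi[OF assms], of "{0<..}"])
    (use assms in \<open>auto simp: deriv_renyi\<close>)

text \<open>The second derivative test covers the open half-line. Segments with an endpoint at 0
  reduce to s \<le> s \<open>powr\<close> (1 - 1/N) for s between 0 and 1.\<close>

lemma convex_on_renyi:
  assumes "1 < N"
  shows "convex_on {0..} (renyi N)"
proof (rule convex_onI)
  have "convex_on {0<..} (renyi N)"
    using assms
    by (intro f''_ge0_imp_convex[OF _ has_real_derivative_renyi has_real_derivative_deriv_renyi]) auto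
  then have pos: "renyi N ((1 - t) *\<^sub>R x + t *\<^sub>R y) \<le> (1 - t) * renyi N x + t * renyi N y"
    if "0 < x" "0 < y" "0 < t" "t < 1" for x y t
    using that by (intro convex_onD) auto
  have scale: "renyi N (s * x) \<le> s * renyi N x" if "0 < s" "s < 1" "0 \<le> x" for s x
  proof -
    have "s powr 1 \<le> s powr (1 - 1 / N)"
      using that assms by (intro powr_mono') auto
    then show ?thesis
      using that by (simp add: renyi_def powr_mult mult_right_mono)
  qed
  fix t x y :: real
  assume *: "0 < t" "t < 1" "x \<in> {0..}" "y \<in> {0..}"
  then consider "0 < x" "0 < y" | "x = 0" | "y = 0"
    by fastforce
  then show "renyi N ((1 - t) *\<^sub>R x + t *\<^sub>R y) \<le> (1 - t) * renyi N x + t * renyi N y"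
  proof cases
    case 1
    then show ?thesis using * pos by blast
  next
    case 2
    then show ?thesis using * scale[of t y] by (simp add: renyi_def)
  next
    case 3
    then show ?thesis using * scale[of "1 - t" x] by (simp add: renyi_def)
  qed
qed simp

lemma renyi_DC:
  assumes "1 < N"
  shows "renyi N \<in> DC N"
proof -
  have "continuous_on {0..} (renyi N)"
    unfolding renyi_def using assms
    by (intro continuous_on_minus continuous_on_powr' continuous_intros) auto
  moreover have "renyi N differentiable (at r)" "deriv (renyi N) differentiable (at r)"
    if "0 < r" for r
    using has_real_derivative_renyi[OF that] has_real_derivative_deriv_renyi'[OF assms that]
    by (auto simp: real_differentiable_def)
  moreover have "continuous_on {0<..} (deriv (deriv (renyi N)))"
  proof -
    have "continuous_on {0<..} (\<lambda>r. (1 - 1 / N) * (1 / N) * r powr (- 1 / N - 1))"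
      by (intro continuous_intros) auto
    then show ?thesis
      by (rule continuous_on_eq)
        (simp add: DERIV_imp_deriv[OF has_real_derivative_deriv_renyi'[OF assms]])
  qed
  \<comment> \<open>The quotient is constant, so the function is a borderline member of
    \<open>DC N\<close>.\<close>
  moreover have "pressure (renyi N) r / r powr (1 - 1 / N) = 1 / N" if "0 < r" for r
  proof -
    have "r * r powr (- 1 / N) = r powr (1 - 1 / N)"
      using that powr_add[of r 1 "- 1 / N"] by simp
    then have "pressure (renyi N) r = (1 / N) * r powr (1 - 1 / N)"
      using that by (simp add: pressure_def deriv_renyi renyi_def algebra_simps)
    then show ?thesis
      using that by simp
  qed
  then have "mono_on {0<..} (\<lambda>r. pressure (renyi N) r / r powr (1 - 1 / N))"
    by (intro mono_onI) simp
  ultimately show ?thesis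
    using convex_on_renyi[OF assms] by (simp add: DC_def renyi_def[of _ 0])
qed

text \<open>With this slope the singular parts drop out of all the functionals.\<close>

lemma slope_at_infinity_renyi:
  assumes "1 < N"
  shows "slope_at_infinity (renyi N) = 0"
proof -
  have "((\<lambda>r. renyi N r / r) \<longlongrightarrow> 0) at_top"
    unfolding renyi_def using assms by real_asymp
  then have "((\<lambda>r. ereal (renyi N r / r)) \<longlongrightarrow> 0) at_top"
    by (simp add: zero_ereal_def)
  then show ?thesis
    unfolding slope_at_infinity_def by (intro tendsto_Lim) auto
qed

lemma slope_at_zero_renyi:
  assumes "1 < N"
  shows "slope_at_zero (renyi N) = -\<infinity>"
proof -
  have "filterlim (\<lambda>r. renyi N r / r) at_bot (at_right 0)"
    unfolding renyi_def using assms by real_asymp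
  then have "((\<lambda>r. ereal (renyi N r / r)) \<longlongrightarrow> -\<infinity>) (at_right 0)"
    by (simp add: ereal_tendsto_simps2(3)[unfolded comp_def])
  then show ?thesis
    unfolding slope_at_zero_def by (intro tendsto_Lim) auto
qed

section \<open>Entropy functionals of the Renyi function\<close>

lemma perspective_renyi_nonpos:
  assumes "1 < N" "0 \<le> r" "0 \<le> b"
  shows "perspective (renyi N) r b \<le> 0"
proof (cases "b = \<infinity>")
  \<comment> \<open>For positive \<open>r\<close> the value is -\<infinity>; for
    \<open>r = 0\<close> the product of 0 and -\<infinity> is 0 in the extended reals.\<close>
  case True
  then show ?thesis
    using assms by (simp add: perspective_def slope_at_zero_renyi)
next
  case False
  then show ?thesis
    using assms mult_nonpos_nonneg[OF renyi_nonpos]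
    by (simp add: perspective_def real_of_ereal_pos)
qed

lemma perspective_renyi_infinity:
  assumes "1 < N" "0 < r"
  shows "perspective (renyi N) r \<infinity> = -\<infinity>"
  using assms by (simp add: perspective_def slope_at_zero_renyi)

text \<open>Since \<mu> gives no mass to the complement of \<open>C\<close>, its density vanishes
  there \<nu>-almost everywhere. The negative part is therefore dominated by the indicator of
  \<open>C\<close> plus the density, both of finite integral.\<close>

lemma U_functional_renyi_gt_minf:
  assumes N: "1 < N" and "sigma_finite_measure \<nu>" "prob_space \<mu>" "sets \<mu> = sets \<nu>"
    and C: "C \<in> sets \<nu>" "emeasure \<nu> C < \<infinity>" "AE x in \<mu>. x \<in> C"
  shows "-\<infinity> < U_functional (renyi N) \<nu> \<mu>"
proof -
  interpret \<mu>: prob_space \<mu> by fact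
  have space: "space \<mu> = space \<nu>"
    using assms(4) by (rule sets_eq_imp_space_eq)
  let ?\<rho> = "ac_density \<nu> \<mu>"
  have dec: "lebesgue_decomposition \<nu> \<mu> ?\<rho> (singular_part \<nu> \<mu>)"
    using assms(2,4) \<mu>.finite_measure_axioms by (intro lebesgue_decomposition_chosen)
  then have \<rho>[measurable]: "?\<rho> \<in> borel_measurable \<nu>" and pos: "\<And>x. 0 \<le> ?\<rho> x"
    by (simp_all add: lebesgue_decomposition_def)
  note [measurable] = C(1)
  have "emeasure \<mu> (space \<nu> - C) = 0"
    using AE_iff_measurable[of "space \<nu> - C" \<mu> "\<lambda>x. x \<in> C"] C(1,3)
    by (simp add: space assms(4) set_diff_eq)
  then have "(\<integral>\<^sup>+ x. ennreal (?\<rho> x) * indicator (space \<nu> - C) x \<partial>\<nu>) = 0"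
    using nn_integral_ac_density_le[OF dec, of "space \<nu> - C"] by simp
  then have AE: "AE x in \<nu>. ennreal (?\<rho> x) * indicator (space \<nu> - C) x = 0"
    by (subst (asm) nn_integral_0_iff_AE) auto
  have le: "ennreal (- renyi N r) \<le> 1 + ennreal r" if "0 \<le> r" for r
  proof -
    have "r powr (1 - 1 / N) \<le> 1 + r"
    proof (cases "r \<le> 1")
      case True
      then have "r powr (1 - 1 / N) \<le> 1"
        using that N by (intro powr_le1) auto
      then show ?thesis using that by simp
    next
      case False
      then have "r powr (1 - 1 / N) \<le> r powr 1"
        using N by (intro powr_mono) auto
      then show ?thesis using False by simp
    qed
    then have "ennreal (- renyi N r) \<le> ennreal (1 + r)"
      by (simp add: renyi_def ennreal_leI)
    then show ?thesis
      using that by simp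
  qed
  \<comment> \<open>The indicator of the whole space merely brings the last integral into the form
    of \<open>nn_integral_ac_density_le\<close>.\<close>
  have "(\<integral>\<^sup>+ x. ennreal (- renyi N (?\<rho> x)) \<partial>\<nu>)
      \<le> (\<integral>\<^sup>+ x. indicator C x + ennreal (?\<rho> x) * indicator (space \<nu>) x \<partial>\<nu>)"
  proof (rule nn_integral_mono_AE)
    show "AE x in \<nu>. ennreal (- renyi N (?\<rho> x))
        \<le> indicator C x + ennreal (?\<rho> x) * indicator (space \<nu>) x"
      using AE AE_space
    proof eventually_elim
      case (elim x)
      show ?case
      proof (cases "x \<in> C")
        case True
        then show ?thesis using elim le pos by simp
      next
        case False
        then have "?\<rho> x = 0"
          using elim pos[of x] by (simp add: ennreal_eq_0_iff)
        then show ?thesis by (simp add: renyi_def)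
      qed
    qed
  qed
  also have "\<dots> = emeasure \<nu> C + (\<integral>\<^sup>+ x. ennreal (?\<rho> x) * indicator (space \<nu>) x \<partial>\<nu>)"
    by (subst nn_integral_add) auto
  also have "\<dots> \<le> emeasure \<nu> C + emeasure \<mu> (space \<nu>)"
    by (intro add_left_mono nn_integral_ac_density_le[OF dec]) auto
  also have "\<dots> < \<infinity>"
    using C(2) by (simp add: \<mu>.emeasure_finite less_top[symmetric])
  finally have fin: "(\<integral>\<^sup>+ x. ennreal (- renyi N (?\<rho> x)) \<partial>\<nu>) < \<infinity>" .
  have "ennreal (renyi N r) = 0" for r
    by (simp add: ennreal_eq_0_iff renyi_nonpos)
  then have "U_functional (renyi N) \<nu> \<mu> =
      - enn2ereal (\<integral>\<^sup>+ x. ennreal (- renyi N (?\<rho> x)) \<partial>\<nu>)"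
    by (simp add: U_functional_def slope_at_infinity_renyi[OF N] zero_ennreal.rep_eq)
  then show ?thesis
    using fin by (cases "\<integral>\<^sup>+ x. ennreal (- renyi N (?\<rho> x)) \<partial>\<nu>") auto
qed

text \<open>The integrand is nonpositive and the slope at infinity is 0, so only the negative part
  survives and \<infinity> - \<infinity> cannot occur.\<close>

lemma U_beta_functional_renyi:
  assumes "1 < N" "\<And>x. 0 \<le> ac_density \<nu> \<mu> x" "\<And>x y. 0 \<le> \<beta> x y"
  shows "U_beta_functional (renyi N) \<beta> \<kappa> \<nu> \<mu> = - enn2ereal
    (\<integral>\<^sup>+ x. \<integral>\<^sup>+ y. e2ennreal (- perspective (renyi N) (ac_density \<nu> \<mu> x) (\<beta> x y)) \<partial>\<kappa> x \<partial>\<nu>)"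
proof -
  have "e2ennreal (perspective (renyi N) (ac_density \<nu> \<mu> x) (\<beta> x y)) = 0" for x y
    using perspective_renyi_nonpos[OF assms(1) assms(2) assms(3)] by (rule e2ennreal_neg)
  then show ?thesis
    by (simp add: U_beta_functional_def slope_at_infinity_renyi[OF assms(1)] zero_ennreal.rep_eq)
qed

text \<open>The plan gives no mass to pairs whose second entry lies outside \<open>B\<close>. That
  mass is the integral of the kernel masses of the complement of \<open>B\<close>, which therefore
  vanish almost everywhere.\<close>

lemma AE_disintegration:
  assumes "disintegration \<mu> \<pi> \<kappa>" "coupling \<mu> \<mu>1 \<pi>" "sets \<mu>1 = sets \<mu>" "B \<in> sets \<mu>"
    and "AE y in \<mu>1. y \<in> B"
  shows "AE x in \<mu>. emeasure (\<kappa> x) B = 1"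
proof -
  have space: "space \<mu>1 = space \<mu>"
    using assms(3) by (rule sets_eq_imp_space_eq)
  have \<kappa>: "\<kappa> \<in> \<mu> \<rightarrow>\<^sub>M prob_algebra \<mu>" and sets: "sets \<pi> = sets (\<mu> \<Otimes>\<^sub>M \<mu>)"
    and dis: "\<And>A. A \<in> sets (\<mu> \<Otimes>\<^sub>M \<mu>) \<Longrightarrow> emeasure \<pi> A = (\<integral>\<^sup>+ x. emeasure (\<kappa> x) (Pair x -` A) \<partial>\<mu>)"
    using assms(1) by (auto simp: disintegration_def)
  have [measurable]: "snd \<in> \<pi> \<rightarrow>\<^sub>M \<mu>1"
    using measurable_cong_sets[OF sets assms(3)] measurable_snd by blast
  let ?D = "space \<mu> - B"
  have D[measurable]: "?D \<in> sets \<mu>" "?D \<in> sets \<mu>1"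
    using assms(3,4) by auto
  have "0 = emeasure \<mu>1 ?D"
    using AE_iff_measurable[of ?D \<mu>1 "\<lambda>y. y \<in> B"] D(2) assms(5)
    by (simp add: space set_diff_eq)
  also have "\<dots> = emeasure (distr \<pi> \<mu>1 snd) ?D"
    using assms(2) by (simp add: coupling_def)
  also have "\<dots> = emeasure \<pi> (space \<mu> \<times> ?D)"
    using D by (subst emeasure_distr)
      (auto intro!: arg_cong[where f="emeasure \<pi>"] simp: sets_eq_imp_space_eq[OF sets] space_pair_measure)
  also have "\<dots> = (\<integral>\<^sup>+ x. emeasure (\<kappa> x) ?D \<partial>\<mu>)"
    using D(1) by (subst dis) (auto intro!: nn_integral_cong arg_cong2[where f=emeasure])
  finally have "(\<integral>\<^sup>+ x. emeasure (\<kappa> x) ?D \<partial>\<mu>) = 0"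
    by simp
  moreover have "(\<lambda>x. emeasure (\<kappa> x) ?D) \<in> borel_measurable \<mu>"
    by (rule measurable_compose[OF measurable_prob_algebraD[OF \<kappa>] measurable_emeasure_subprob_algebra])
      (rule D)
  ultimately have "AE x in \<mu>. emeasure (\<kappa> x) ?D = 0"
    by (simp add: nn_integral_0_iff_AE)
  then show ?thesis
    using AE_space
  proof eventually_elim
    case (elim x)
    then have "\<kappa> x \<in> space (prob_algebra \<mu>)"
      using measurable_space[OF \<kappa>] by blast
    then have P: "prob_space (\<kappa> x)" "sets (\<kappa> x) = sets \<mu>"
      by (auto simp: space_prob_algebra)
    interpret P: prob_space "\<kappa> x" by (rule P)
    have "emeasure (\<kappa> x) (space \<mu>) = emeasure (\<kappa> x) B + emeasure (\<kappa> x) ?D"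
      using assms(4) D P(2) sets.sets_into_space[OF assms(4)]
      by (subst plus_emeasure) (auto intro!: arg_cong[where f="emeasure (\<kappa> x)"])
    then show ?case
      using elim P.emeasure_space_1 by (simp add: sets_eq_imp_space_eq[OF P(2)])
  qed
qed

text \<open>For \<mu>-almost every \<open>x\<close> the density is positive and the kernel is
  concentrated on \<open>B\<close>, where the coefficient is \<infinity>; so the inner integral of
  the negative part diverges.\<close>

lemma U_beta_functional_renyi_eq_minf:
  assumes N: "1 < N" and "sigma_finite_measure \<nu>" "prob_space \<mu>" and sets: "sets \<mu> = sets \<nu>"
    and ac: "absolutely_continuous \<nu> \<mu>"
    and dis: "disintegration \<mu> \<pi> \<kappa>" "coupling \<mu> \<mu>1 \<pi>" "sets \<mu>1 = sets \<mu>"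
    and AE: "AE x in \<mu>. x \<in> A" "B \<in> sets \<mu>" "AE y in \<mu>1. y \<in> B"
    and \<beta>: "\<And>x y. 0 \<le> \<beta> x y" "\<And>x y. x \<in> A \<Longrightarrow> y \<in> B \<Longrightarrow> \<beta> x y = \<infinity>"
  shows "U_beta_functional (renyi N) \<beta> \<kappa> \<nu> \<mu> = -\<infinity>"
proof -
  interpret \<mu>: prob_space \<mu> by fact
  have space: "space \<mu> = space \<nu>"
    using sets by (rule sets_eq_imp_space_eq)
  let ?\<rho> = "ac_density \<nu> \<mu>"
  let ?f = "\<lambda>x y. e2ennreal (- perspective (renyi N) (?\<rho> x) (\<beta> x y))"
  have dec: "lebesgue_decomposition \<nu> \<mu> ?\<rho> (singular_part \<nu> \<mu>)"
    using assms(2) sets \<mu>.finite_measure_axioms by (intro lebesgue_decomposition_chosen)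
  then have pos: "\<And>x. 0 \<le> ?\<rho> x"
    by (simp add: lebesgue_decomposition_def)
  have "AE x in \<mu>. (\<integral>\<^sup>+ y. ?f x y \<partial>\<kappa> x) = \<infinity>"
    using AE_disintegration[OF dis AE(2,3)] AE_ac_density_pos[OF dec ac sets] AE(1) AE_space
  proof eventually_elim
    case (elim x)
    then have "\<kappa> x \<in> space (prob_algebra \<mu>)"
      using dis(1) unfolding disintegration_def by (auto dest: measurable_space)
    then have B: "B \<in> sets (\<kappa> x)"
      using AE(2) by (auto simp: space_prob_algebra)
    have "\<infinity> * emeasure (\<kappa> x) B = (\<integral>\<^sup>+ y. \<infinity> * indicator B y \<partial>\<kappa> x)"
      using B by (simp add: nn_integral_cmult_indicator)
    also have "\<dots> \<le> (\<integral>\<^sup>+ y. ?f x y \<partial>\<kappa> x)"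
      using elim \<beta>(2) N
      by (intro nn_integral_mono) (auto simp: perspective_renyi_infinity split: split_indicator)
    finally show ?case
      using elim by (simp add: top_unique)
  qed
  then obtain Z where Z: "Z \<in> null_sets \<mu>"
    "\<And>x. x \<in> space \<nu> - Z \<Longrightarrow> (\<integral>\<^sup>+ y. ?f x y \<partial>\<kappa> x) = \<infinity>"
    using space by (auto elim!: AE_E3)
  \<comment> \<open>The inner integral need not be measurable in \<open>x\<close>; a lower bound off the measurable set \<open>Z\<close>
    suffices, since the integral of a non-measurable function is its lower integral.\<close>
  have Z_sets: "space \<nu> - Z \<in> sets \<nu>"
    using Z(1) sets by auto
  \<comment> \<open>Divergence is known \<mu>-almost everywhere, while the outer integral is taken
    against \<nu>. Absolute continuity bridges the gap: a set of full \<mu>-measure cannot be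
    \<nu>-null.\<close>
  have "emeasure \<nu> (space \<nu> - Z) \<noteq> 0"
  proof
    assume "emeasure \<nu> (space \<nu> - Z) = 0"
    then have "space \<nu> - Z \<in> null_sets \<mu>"
      using ac Z_sets unfolding absolutely_continuous_def by blast
    then have "(space \<nu> - Z) \<union> Z \<in> null_sets \<mu>"
      using Z(1) by (rule null_sets.Un)
    then have "emeasure \<mu> (space \<mu>) \<le> 0"
      using emeasure_mono[of "space \<mu>" "(space \<nu> - Z) \<union> Z" \<mu>] space by (auto simp: null_sets_def)
    then show False
      by (simp add: \<mu>.emeasure_space_1)
  qed
  then have "\<infinity> = (\<integral>\<^sup>+ x. \<infinity> * indicator (space \<nu> - Z) x \<partial>\<nu>)"
    unfolding nn_integral_cmult_indicator[OF Z_sets] by (simp add: ennreal_top_mult)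
  also have "\<dots> \<le> (\<integral>\<^sup>+ x. \<integral>\<^sup>+ y. ?f x y \<partial>\<kappa> x \<partial>\<nu>)"
    using Z(2) by (intro nn_integral_mono) (auto split: split_indicator)
  finally have "(\<integral>\<^sup>+ x. \<integral>\<^sup>+ y. ?f x y \<partial>\<kappa> x \<partial>\<nu>) = \<infinity>"
    by (simp add: top_unique)
  then show ?thesis
    by (simp add: U_beta_functional_renyi[OF N pos \<beta>(1)])
qed

text \<open>Values of \<open>powr\<close> are nonnegative for every base, so the sign of the
  quotient of sines does not matter.\<close>

lemma betaKN_nonneg: "0 \<le> betaKN d K t N x y"
  by (simp add: betaKN_def)

section \<open>Dynamical plans\<close>

text \<open>Evaluation at \<open>t\<close> is continuous: the preimage of an open set is the
  generating set of the compact-open topology for the compact set \<open>{t}\<close>.\<close>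

lemma measurable_evaluation:
  assumes "irreversible_metric d" "0 \<le> t" "t \<le> 1"
  shows "(\<lambda>\<gamma>. \<gamma> t) \<in> borel_of (geodesic_topology d) \<rightarrow>\<^sub>M forward_borel d"
proof (rule continuous_map_borel_of_measurable)
  have gen: "openin (geodesic_topology d) {\<gamma> \<in> geodesics d. \<gamma> ` {t} \<subseteq> V}"
    if "openin (forward_topology d) V" for V
    unfolding geodesic_topology_def
  proof (intro topology_generated_by_Basis CollectI exI conjI)
    show "compact {t}" "{t} \<subseteq> {0..1}"
      using assms by auto
  qed (use that in auto)
  have "topspace (geodesic_topology d) \<subseteq> geodesics d"
    unfolding geodesic_topology_def topology_generated_by_topspace by blast
  moreover have "geodesics d \<subseteq> topspace (geodesic_topology d)"
    using openin_subset[OF gen[OF openin_topspace]]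
    by (simp add: topspace_forward_topology[OF assms(1)])
  ultimately have top: "topspace (geodesic_topology d) = geodesics d"
    by blast
  show "continuous_map (geodesic_topology d) (forward_topology d) (\<lambda>\<gamma>. \<gamma> t)"
    unfolding continuous_map_def top using gen
    by (simp add: topspace_forward_topology[OF assms(1)])
qed

lemma space_geodesic_borel: "space (borel_of (geodesic_topology d)) \<subseteq> geodesics d"
  unfolding space_borel_of geodesic_topology_def topology_generated_by_topspace by blast

text \<open>The marginal properties are pulled back through the endpoint plan to the endpoints of
  almost every geodesic, applied curve by curve, and pushed forward under evaluation at
  \<open>t\<close>.\<close>

lemma AE_interpolation:
  assumes d: "irreversible_metric d" and dyn: "dynamical_optimal_plan d \<mu>0 \<mu>1 Q"
    and sets: "sets \<mu>0 = sets (forward_borel d)" "sets \<mu>1 = sets (forward_borel d)"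
    and AE: "AE x in \<mu>0. P x" "AE y in \<mu>1. R y"
    and t: "0 \<le> t" "t \<le> 1" and C: "C \<in> sets (forward_borel d)"
    and imp: "\<And>\<gamma>. \<gamma> \<in> geodesics d \<Longrightarrow> P (\<gamma> 0) \<Longrightarrow> R (\<gamma> 1) \<Longrightarrow> \<gamma> t \<in> C"
  shows "AE z in interpolation d Q t. z \<in> C"
proof -
  let ?G = "forward_borel d"
  have Q: "sets Q = sets (borel_of (geodesic_topology d))"
    and cpl: "coupling \<mu>0 \<mu>1 (endpoint_plan d Q)"
    using dyn by (auto simp: dynamical_optimal_plan_def optimal_plan_def)
  have ev: "(\<lambda>\<gamma>. \<gamma> s) \<in> Q \<rightarrow>\<^sub>M ?G" if "0 \<le> s" "s \<le> 1" for s
    using measurable_evaluation[OF d that] measurable_cong_sets[OF Q refl] by blast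
  then have pair: "(\<lambda>\<gamma>. (\<gamma> 0, \<gamma> 1)) \<in> Q \<rightarrow>\<^sub>M ?G \<Otimes>\<^sub>M ?G"
    by (intro measurable_Pair) auto
  have sets_e: "sets (endpoint_plan d Q) = sets (?G \<Otimes>\<^sub>M ?G)"
    by (simp add: endpoint_plan_def)
  have fst: "fst \<in> endpoint_plan d Q \<rightarrow>\<^sub>M \<mu>0" and snd: "snd \<in> endpoint_plan d Q \<rightarrow>\<^sub>M \<mu>1"
    using measurable_cong_sets[OF sets_e sets(1)] measurable_cong_sets[OF sets_e sets(2)]
      measurable_fst measurable_snd by blast+
  have marginals: "distr (endpoint_plan d Q) \<mu>0 fst = \<mu>0" "distr (endpoint_plan d Q) \<mu>1 snd = \<mu>1"
    using cpl unfolding coupling_def by blast+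
  have "AE x in distr (endpoint_plan d Q) \<mu>0 fst. P x"
    "AE y in distr (endpoint_plan d Q) \<mu>1 snd. R y"
    using AE by (simp_all only: marginals)
  then have "AE p in endpoint_plan d Q. P (fst p)" "AE p in endpoint_plan d Q. R (snd p)"
    using AE_distrD fst snd by blast+
  then have "AE \<gamma> in Q. P (\<gamma> 0)" "AE \<gamma> in Q. R (\<gamma> 1)"
    unfolding endpoint_plan_def using AE_distrD[OF pair] by fastforce+
  then have "AE \<gamma> in Q. \<gamma> t \<in> C"
    using AE_space
  proof eventually_elim
    case (elim \<gamma>)
    then show ?case
      using imp space_geodesic_borel sets_eq_imp_space_eq[OF Q] by blast
  qed
  moreover have "{z \<in> space ?G. z \<in> C} \<in> sets ?G"
    using C by simp
  ultimately show ?thesis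
    unfolding interpolation_def by (subst AE_distr_iff[OF ev[OF t]])
qed


lemma prob_space_interpolation:
  assumes "irreversible_metric d" "dynamical_optimal_plan d \<mu>0 \<mu>1 Q" "0 \<le> t" "t \<le> 1"
  shows "prob_space (interpolation d Q t)"
proof -
  have Q: "prob_space Q" "sets Q = sets (borel_of (geodesic_topology d))"
    using assms(2) by (auto simp: dynamical_optimal_plan_def)
  have "(\<lambda>\<gamma>. \<gamma> t) \<in> Q \<rightarrow>\<^sub>M forward_borel d"
    using measurable_evaluation[OF assms(1,3,4)] measurable_cong_sets[OF Q(2) refl] by blast
  then show ?thesis
    unfolding interpolation_def by (rule prob_space.prob_space_distr[OF Q(1)])
qed

text \<open>Go from \<open>x\<close> to the start of the curve (less than 1), then along it. Its
  full length is at most the way back to \<open>x\<close> (at most \<open>c\<close>), then to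
  \<open>y\<close>, then to its end (less than 1).\<close>

lemma geodesic_in_forward_ball:
  assumes "irreversible_metric d" "\<gamma> \<in> geodesics d" "0 \<le> t" "t \<le> 1"
    and "d x (\<gamma> 0) < 1" "d (\<gamma> 0) x \<le> c" "d y (\<gamma> 1) < 1"
  shows "\<gamma> t \<in> forward_ball d x (c + d x y + 2)"
proof -
  note d = irreversible_metricD[OF assms(1)]
  have "d (\<gamma> 0) (\<gamma> t) = (t - 0) * d (\<gamma> 0) (\<gamma> 1)"
    using assms(2-4) unfolding geodesics_def by blast
  also have "\<dots> \<le> 1 * d (\<gamma> 0) (\<gamma> 1)"
    using assms(4) by (intro mult_right_mono d(1)) simp
  finally have "d (\<gamma> 0) (\<gamma> t) \<le> d (\<gamma> 0) (\<gamma> 1)"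
    by simp
  moreover have "d (\<gamma> 0) (\<gamma> 1) \<le> d (\<gamma> 0) x + d x (\<gamma> 1)"
    by (rule d)
  moreover have "d x (\<gamma> 1) \<le> d x y + d y (\<gamma> 1)"
    by (rule d)
  moreover have "d x (\<gamma> t) \<le> d x (\<gamma> 0) + d (\<gamma> 0) (\<gamma> t)"
    by (rule d)
  ultimately show ?thesis
    using assms(5-7) by (simp add: forward_ball_def)
qed

section \<open>The diameter bound\<close>

theorem theorem5p11:
  fixes d :: "'a \<Rightarrow> 'a \<Rightarrow> real" and \<nu> :: "'a measure" and K N :: real
  assumes "weak_CD d \<nu> K N"
    and "K > 0"
    and "N > 1"
  shows "Diam d (supp d \<nu>) \<le> ennreal (pi * sqrt ((N - 1) / K))"
proof (rule ccontr)
  define D where "D = pi * sqrt ((N - 1) / K)"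
  have "0 \<le> D"
    using assms(2,3) by (simp add: D_def)
  assume "\<not> ?thesis"
  then obtain x0 x1 where supp: "x0 \<in> supp d \<nu>" "x1 \<in> supp d \<nu>"
    and "ennreal D < ennreal (d x0 x1)"
    unfolding not_le Diam_def less_SUP_iff D_def by blast
  moreover have "ennreal (d x0 x1) \<le> Diam d UNIV"
    unfolding Diam_def by (intro SUP_upper2[of x0] SUP_upper2[of x1]) auto
  \<comment> \<open>The case defined by a limit \<open>N' \<rightarrow> N\<close> in \<open>U_KN_functional\<close> is thereby excluded.\<close>
  ultimately have diam: "Diam d UNIV \<noteq> ennreal (pi * sqrt ((N - 1) / K))"
    and far: "D < d x0 x1"
    using \<open>0 \<le> D\<close> by (auto simp: D_def[symmetric] ennreal_less_iff)
  have fms: "forward_metric_space d" and fbc: "forward_boundedly_compact d"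
    and lf: "locally_finite_borel_measure d \<nu>" and sf: "sigma_finite_measure \<nu>"
    using assms(1) by (auto simp: weak_CD_def forward_geodesic_space_def)
  have d: "irreversible_metric d"
    using fms by (simp add: forward_metric_space_def)
  have sets: "sets \<nu> = sets (forward_borel d)"
    using lf by (simp add: locally_finite_borel_measure_def)
  obtain c0 where c0: "1 \<le> c0"
    "\<And>y z. y \<in> forward_ball d x0 1 \<Longrightarrow> z \<in> forward_ball d x0 1 \<Longrightarrow> d y z \<le> c0 * d z y"
    using locally_reversible[OF fms] by blast
  obtain c1 where c1: "1 \<le> c1"
    "\<And>y z. y \<in> forward_ball d x1 1 \<Longrightarrow> z \<in> forward_ball d x1 1 \<Longrightarrow> d y z \<le> c1 * d z y"
    using locally_reversible[OF fms] by blast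
  \<comment> \<open>A point of the first ball costs at most \<open>r\<close>, and one of the second
    at most \<open>c1 * r\<close>, since its distance to the centre is a reversed one. The total
    must fit into \<open>d x0 x1 - D\<close>; the cap 1 makes local reversibility
    applicable.\<close>
  define r where "r = min 1 ((d x0 x1 - D) / (1 + c1))"
  have r: "0 < r" "r \<le> 1" "r * (1 + c1) \<le> d x0 x1 - D"
  proof -
    show "0 < r" "r \<le> 1"
      using c1(1) far by (auto simp: r_def)
    have "r * (1 + c1) \<le> (d x0 x1 - D) / (1 + c1) * (1 + c1)"
      using c1(1) by (intro mult_right_mono) (auto simp: r_def)
    then show "r * (1 + c1) \<le> d x0 x1 - D"
      using c1(1) by simp
  qed
  define B0 where "B0 = forward_ball d x0 r"
  define B1 where "B1 = forward_ball d x1 r"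
  have B_sets: "B0 \<in> sets \<nu>" "B1 \<in> sets \<nu>"
    unfolding B0_def B1_def sets by (intro sets_borel_of_openin openin_forward_ball r(1))+
  have dist: "D \<le> d x y" if "x \<in> B0" "y \<in> B1" for x y
  proof -
    have "d y x1 \<le> c1 * d x1 y"
      using that r by (intro c1(2) centre_in_forward_ball[OF d]) (auto simp: B1_def forward_ball_def)
    also have "\<dots> \<le> c1 * r"
      using that c1(1) by (simp add: B1_def forward_ball_def)
    finally have "d y x1 \<le> c1 * r" .
    moreover have "d x0 x1 \<le> d x0 x + d x x1" "d x x1 \<le> d x y + d y x1"
      by (rule irreversible_metricD[OF d])+
    moreover have "d x0 x < r"
      using that by (simp add: B0_def forward_ball_def)
    ultimately show ?thesis
      using r(3) by (simp add: algebra_simps)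
  qed
  define \<mu>0 where "\<mu>0 = uniform_measure \<nu> B0"
  define \<mu>1 where "\<mu>1 = uniform_measure \<nu> B1"
  have sets_\<mu>: "sets \<mu>0 = sets \<nu>" "sets \<mu>1 = sets \<nu>"
    by (simp_all add: \<mu>0_def \<mu>1_def)
  note ball = compactly_supported_uniform_measure[OF fms fbc lf _ r(1)]
  have prob: "prob_space \<mu>0" "prob_space \<mu>1"
    unfolding \<mu>0_def \<mu>1_def B0_def B1_def by (intro ball supp)+
  have AE: "AE x in \<mu>0. x \<in> B0" "AE x in \<mu>1. x \<in> B1"
    unfolding \<mu>0_def \<mu>1_def using B_sets by (auto intro: AE_uniform_measureI)
  have ac: "absolutely_continuous \<nu> \<mu>0"
    unfolding \<mu>0_def uniform_measure_def using B_sets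
    by (intro absolutely_continuousI_density) auto
  have "compactly_supported_prob d \<mu>0" "compactly_supported_prob d \<mu>1"
    "supp d \<mu>0 \<subseteq> supp d \<nu>" "supp d \<mu>1 \<subseteq> supp d \<nu>"
    unfolding \<mu>0_def \<mu>1_def B0_def B1_def by (intro ball supp)+
  then obtain Q \<kappa>0 \<kappa>1 where Q: "dynamical_optimal_plan d \<mu>0 \<mu>1 Q"
    and dis: "disintegration \<mu>0 (endpoint_plan d Q) \<kappa>0"
    and CD: "\<And>U t. U \<in> DC N \<Longrightarrow> t \<in> {0..1} \<Longrightarrow> U_functional U \<nu> (interpolation d Q t)
        \<le> ereal (1 - t) * U_KN_functional d K N U (betaKN d K (1 - t)) \<kappa>0 \<nu> \<mu>0
          + ereal t * U_KN_functional d K N U (\<lambda>N' x y. betaKN d K t N' y x) \<kappa>1 \<nu> \<mu>1"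
    using assms(1) unfolding weak_CD_def by metis
  have cpl: "coupling \<mu>0 \<mu>1 (endpoint_plan d Q)"
    using Q by (auto simp: dynamical_optimal_plan_def optimal_plan_def)
  let ?F0 = "U_beta_functional (renyi N) (betaKN d K (1 / 2) N) \<kappa>0 \<nu> \<mu>0"
  let ?F1 = "U_beta_functional (renyi N) (\<lambda>x y. betaKN d K (1 / 2) N y x) \<kappa>1 \<nu> \<mu>1"
  \<comment> \<open>At time 1/2 both coefficients have the nonzero parameter 1/2, so the infinite
    branch of \<open>betaKN\<close> is available, and \<open>?F0\<close> has positive weight, so a
    value -\<infinity> survives.\<close>
  have "U_functional (renyi N) \<nu> (interpolation d Q (1 / 2))
      \<le> ereal (1 / 2) * ?F0 + ereal (1 / 2) * ?F1"
    using CD[OF renyi_DC[OF assms(3)], of "1 / 2"] diam by (simp add: U_KN_functional_def)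
  moreover have "?F0 = -\<infinity>"
  proof (rule U_beta_functional_renyi_eq_minf[OF assms(3) sf prob(1) sets_\<mu>(1) ac dis cpl])
    show "betaKN d K (1 / 2) N x y = \<infinity>" if "x \<in> B0" "y \<in> B1" for x y
      using dist[OF that] assms(2) by (simp add: betaKN_def D_def)
  qed (use AE B_sets sets_\<mu> in \<open>auto simp: betaKN_nonneg\<close>)
  \<comment> \<open>In \<open>ereal\<close> the sum of -\<infinity> and \<infinity> is \<infinity>,
    so the second summand must be kept from being \<infinity>.\<close>
  moreover have "?F1 \<le> 0"
  proof -
    have "lebesgue_decomposition \<nu> \<mu>1 (ac_density \<nu> \<mu>1) (singular_part \<nu> \<mu>1)"
      using sf prob(2) sets_\<mu>(2)
      by (intro lebesgue_decomposition_chosen) (auto simp: prob_space_def)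
    then have "0 \<le> ac_density \<nu> \<mu>1 x" for x
      by (simp add: lebesgue_decomposition_def)
    then show ?thesis
      by (subst U_beta_functional_renyi[OF assms(3)]) (auto simp: betaKN_nonneg)
  qed
  ultimately have "U_functional (renyi N) \<nu> (interpolation d Q (1 / 2)) = -\<infinity>"
    by (cases ?F1) auto
  moreover have "-\<infinity> < U_functional (renyi N) \<nu> (interpolation d Q (1 / 2))"
  proof (rule U_functional_renyi_gt_minf[OF assms(3) sf])
    \<comment> \<open>The radius is that of \<open>geodesic_in_forward_ball\<close>, with
      \<open>c0\<close> bounding the distance from the start of a geodesic back to
      \<open>x0\<close>.\<close>
    let ?C = "forward_ball d x0 (c0 + d x0 x1 + 2)"
    show "prob_space (interpolation d Q (1 / 2))"
      by (rule prob_space_interpolation[OF d Q]) auto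
    show "sets (interpolation d Q (1 / 2)) = sets \<nu>"
      by (simp add: interpolation_def sets)
    have "0 < c0 + d x0 x1 + 2"
      using c0(1) irreversible_metricD(1)[OF d, of x0 x1] by linarith
    then show C: "?C \<in> sets \<nu>"
      unfolding sets by (intro sets_borel_of_openin openin_forward_ball)
    have "compactin (forward_topology d) {y. d x0 y \<le> c0 + d x0 x1 + 2}"
      using fbc by (simp add: forward_boundedly_compact_def)
    then show "emeasure \<nu> ?C < \<infinity>"
      by (rule emeasure_compactin_finite[OF lf]) (auto simp: forward_ball_def)
    show "AE x in interpolation d Q (1 / 2). x \<in> ?C"
    proof (rule AE_interpolation[OF d Q _ _ AE])
      fix \<gamma> assume \<gamma>: "\<gamma> \<in> geodesics d" "\<gamma> 0 \<in> B0" "\<gamma> 1 \<in> B1"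
      then have near: "d x0 (\<gamma> 0) < 1" "d x1 (\<gamma> 1) < 1"
        using r(2) by (auto simp: B0_def B1_def forward_ball_def)
      then have "d (\<gamma> 0) x0 \<le> c0 * d x0 (\<gamma> 0)"
        by (intro c0(2) centre_in_forward_ball[OF d]) (auto simp: forward_ball_def)
      also have "\<dots> \<le> c0"
        using near(1) c0(1) by (simp add: mult_left_le)
      finally show "\<gamma> (1 / 2) \<in> ?C"
        using near \<gamma>(1) by (intro geodesic_in_forward_ball[OF d]) auto
    qed (use C in \<open>simp_all add: sets_\<mu> sets\<close>)
  qed
  ultimately show False
    by simp
qed

end
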